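(* Let $h\ge 1$, let $\boldsymbol{\gamma}_0,\boldsymbol{\gamma}_h\in\mathbb{R}^L$ be linearly independent and let $\theta_{0h}\in(0,\pi)$ be the angle between them. Let $\alpha_0\in[-1,1]$ with $\arccos(\alpha_0)\ge\theta_{0h}$ and put $\alpha_h:=\cos(\arccos(\alpha_0)-\theta_{0h})$ (equivalently, $\alpha_0=\cos(\arccos(\alpha_h)+\theta_{0h})$ with $\arccos(\alpha_h)+\theta_{0h}\le\pi$). Then the primal problem $$\max_{\mathbf{b}\in\mathbb{R}^L}\ \boldsymbol{\gamma}_h'\mathbf{b}\quad\text{subject to}\quad \boldsymbol{\gamma}_0'\mathbf{b}/\|\boldsymbol{\gamma}_0\|=\alpha_0,\quad \mathbf{b}'\mathbf{b}=1$$ and the dual problem $$\min_{\mathbf{b}\in\mathbb{R}^L}\ \boldsymbol{\gamma}_0'\mathbf{b}\quad\text{subject to}\quad \boldsymbol{\gamma}_h'\mathbf{b}/\|\boldsymbol{\gamma}_h\|=\alpha_h,\quad \mathbf{b}'\mathbf{b}=1$$ have the same solution. In particular, the primal solution has the maximal angle with $\boldsymbol{\gamma}_0$ among all unit vectors $\mathbf{b}$ with $\boldsymbol{\gamma}_h'\mathbf{b}/\|\boldsymbol{\gamma}_h\|=\alpha_h$.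
   Context: $(\gamma_k)_{k\in\mathbb{Z}}$ is a square-summable real sequence, $L\ge 1$ is an integer, and for each integer $h\ge 0$, $\boldsymbol{\gamma}_h:=(\gamma_h,\gamma_{h+1},\dots,\gamma_{h+L-1})'\in\mathbb{R}^L$. A prime denotes transposition, $\|\cdot\|$ is the Euclidean norm, and angles between nonzero vectors lie in $[0,\pi]$. *)

theory Defs
  imports "HOL-Analysis.Analysis"
begin

(* Coordinates of real ^ 'n carry no order, so idx fixes which one is the first,
   second, ... entry: it is meant to be a bijection from 'n onto {..<L}, and the vector
   is then (gamma_h, ..., gamma_{h+L-1})'. *)
definition lag_vec :: "(int \<Rightarrow> real) \<Rightarrow> ('n::finite \<Rightarrow> nat) \<Rightarrow> nat \<Rightarrow> real ^ 'n" where
  "lag_vec \<gamma> idx h = (\<chi> i. \<gamma> (int h + int (idx i)))"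

(* Lies in [0, pi] for nonzero vectors; is pi/2 if one of the vectors is 0. *)
definition vangle :: "'a::real_inner \<Rightarrow> 'a \<Rightarrow> real" where
  "vangle x y = arccos (x \<bullet> y / (norm x * norm y))"

end

(* Write gh/|gh| = cos \<theta> u + sin \<theta> e with u = g0/|g0| and e a unit vector orthogonal to u.  A unit
   vector b with u \<bullet> b = cos \<phi> has e \<bullet> b \<le> sin \<phi>, with equality only for s = cos \<phi> u + sin \<phi> e; this
   solves the primal problem.  Replacing (u, w, \<theta>, \<phi>) by (w, -u, pi - \<theta>, \<phi> - \<theta>) turns the primal
   problem into the dual one, and s attains the bound of both. *)

theory Submission
  imports Defs
begin

text \<open>The squared distance expands to 1 - 2 + 1 = 0. This is the equality case of
  Cauchy-Schwarz for unit vectors and the source of uniqueness below.\<close>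

lemma unit_vectors_eq_if_inner_eq_1:
  fixes x y :: "'a::real_inner"
  assumes "norm x = 1" "norm y = 1" "x \<bullet> y = 1"
  shows "x = y"
proof -
  have "(x - y) \<bullet> (x - y) = 0"
    using assms by (simp add: inner_diff inner_commute norm_eq_1)
  then show ?thesis by simp
qed

text \<open>Only the signs of the two sines enter, not the ranges of the angles:
  \<open>0 < sin \<theta>\<close> allows dividing and cancelling by \<open>sin \<theta>\<close>, and
  \<open>0 \<le> sin \<phi>\<close> makes \<open>sin \<phi>\<close> the length of the part of
  \<open>b\<close> orthogonal to \<open>u\<close>. This makes the lemma applicable to both
  problems.\<close>

lemma unique_unit_vector_maximal_inner:
  fixes u w :: "'a::real_inner" and \<theta> \<phi> :: real
  assumes u: "norm u = 1" and w: "norm w = 1" and uw: "u \<bullet> w = cos \<theta>"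
    and "0 < sin \<theta>" and "0 \<le> sin \<phi>"
  obtains s where "norm s = 1" "u \<bullet> s = cos \<phi>" "w \<bullet> s = cos (\<phi> - \<theta>)"
    "\<And>b. \<lbrakk>norm b = 1; u \<bullet> b = cos \<phi>\<rbrakk> \<Longrightarrow> w \<bullet> b \<le> cos (\<phi> - \<theta>)"
    "\<And>b. \<lbrakk>norm b = 1; u \<bullet> b = cos \<phi>; w \<bullet> b = cos (\<phi> - \<theta>)\<rbrakk> \<Longrightarrow> b = s"
proof -
  \<comment> \<open>Gram-Schmidt: \<open>e\<close> is the part of \<open>w\<close> orthogonal to
    \<open>u\<close>, divided by its length \<open>sin \<theta>\<close>.\<close>
  define e where "e = (w - cos \<theta> *\<^sub>R u) /\<^sub>R sin \<theta>"
  define s where "s = cos \<phi> *\<^sub>R u + sin \<phi> *\<^sub>R e"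
  have uu: "u \<bullet> u = 1" and ww: "w \<bullet> w = 1"
    using u w by (simp_all add: norm_eq_1)
  have w_eq: "w = cos \<theta> *\<^sub>R u + sin \<theta> *\<^sub>R e"
    using \<open>0 < sin \<theta>\<close> by (simp add: e_def)
  have ue: "u \<bullet> e = 0"
    by (simp add: e_def inner_diff_right uu uw)
  have "(w - cos \<theta> *\<^sub>R u) \<bullet> (w - cos \<theta> *\<^sub>R u) = (sin \<theta>)\<^sup>2"
    using uw by (simp add: inner_diff uu ww inner_commute[of w u] sin_squared_eq flip: power2_eq_square)
  then have ee: "e \<bullet> e = 1"
    using \<open>0 < sin \<theta>\<close> by (simp add: e_def power2_eq_square) (simp add: field_simps)
  have s: "norm s = 1"
    by (simp add: norm_eq_1 s_def inner_add uu ue ee inner_commute[of e u] flip: power2_eq_square)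
  have us: "u \<bullet> s = cos \<phi>"
    by (simp add: s_def inner_add uu ue)
  have ws: "w \<bullet> s = cos (\<phi> - \<theta>)"
    by (subst w_eq) (simp add: s_def inner_add uu ue ee inner_commute[of e u] cos_diff)
  have wb: "w \<bullet> b = cos \<theta> * cos \<phi> + sin \<theta> * (e \<bullet> b)" if "u \<bullet> b = cos \<phi>" for b
    by (subst w_eq) (simp add: inner_add_left that)
  have sb: "s \<bullet> b = (cos \<phi>)\<^sup>2 + sin \<phi> * (e \<bullet> b)" if "u \<bullet> b = cos \<phi>" for b
    by (simp add: s_def inner_add_left that power2_eq_square)
  have "w \<bullet> b \<le> cos (\<phi> - \<theta>)" if b: "norm b = 1" "u \<bullet> b = cos \<phi>" for b
  proof -
    \<comment> \<open>Cauchy-Schwarz applied to \<open>e\<close> and \<open>b\<close> would only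
      give the bound 1. Since \<open>e\<close> is orthogonal to \<open>u\<close>, \<open>b\<close>
      can be replaced by its orthogonal part \<open>r\<close>, whose norm is
      \<open>sin \<phi>\<close>.\<close>
    define r where "r = b - cos \<phi> *\<^sub>R u"
    have "r \<bullet> r = (sin \<phi>)\<^sup>2"
      using b by (simp add: r_def inner_diff uu norm_eq_1 inner_commute[of b u] sin_squared_eq
          flip: power2_eq_square)
    then have "norm r = sin \<phi>"
      using \<open>0 \<le> sin \<phi>\<close> by (simp add: norm_eq_sqrt_inner)
    moreover have "e \<bullet> b = e \<bullet> r"
      by (simp add: r_def inner_diff_right inner_commute[of e u] ue)
    moreover have "norm e = 1"
      by (simp add: norm_eq_1 ee)
    ultimately have "e \<bullet> b \<le> sin \<phi>"
      using norm_cauchy_schwarz[of e r] by simp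
    then show ?thesis
      using \<open>0 < sin \<theta>\<close> by (simp add: wb[OF b(2)] cos_diff mult.commute)
  qed
  moreover have "b = s" if b: "norm b = 1" "u \<bullet> b = cos \<phi>" "w \<bullet> b = cos (\<phi> - \<theta>)" for b
  proof -
    \<comment> \<open>Attaining the bound forces \<open>e \<bullet> b = sin \<phi>\<close>, and then
      \<open>s \<bullet> b\<close> becomes the sum of the squares of \<open>cos \<phi>\<close> and
      \<open>sin \<phi>\<close>.\<close>
    have "sin \<theta> * (e \<bullet> b) = sin \<theta> * sin \<phi>"
      using wb[OF b(2)] b(3) cos_diff[of \<phi> \<theta>] by (auto simp: mult.commute)
    then have "e \<bullet> b = sin \<phi>"
      using \<open>0 < sin \<theta>\<close> by simp
    then have "s \<bullet> b = 1"
      by (simp add: sb[OF b(2)] flip: power2_eq_square)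
    then show ?thesis
      using unit_vectors_eq_if_inner_eq_1[OF s b(1)] by simp
  qed
  ultimately show ?thesis
    using that s us ws by blast
qed

text \<open>Both sides amount to \<open>arccos a = arccos c + \<theta>\<close>. Each inequality
  keeps the shifted angle inside [0, pi], where \<open>arccos\<close> inverts \<open>cos\<close>;
  the other end of the range follows from \<open>0 \<le> \<theta>\<close>.\<close>

lemma arccos_shift_iff:
  assumes "a \<in> {-1..1}" "c \<in> {-1..1}" "0 \<le> \<theta>"
  shows "(\<theta> \<le> arccos a \<and> c = cos (arccos a - \<theta>)) \<longleftrightarrow>
    (arccos c + \<theta> \<le> pi \<and> a = cos (arccos c + \<theta>))"
proof
  assume L: "\<theta> \<le> arccos a \<and> c = cos (arccos a - \<theta>)"
  have "arccos a \<le> pi"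
    using assms arccos_ubound by auto
  then have "arccos c = arccos a - \<theta>"
    using L assms by (simp add: arccos_cos)
  then show "arccos c + \<theta> \<le> pi \<and> a = cos (arccos c + \<theta>)"
    using \<open>arccos a \<le> pi\<close> assms by simp
next
  assume R: "arccos c + \<theta> \<le> pi \<and> a = cos (arccos c + \<theta>)"
  have "0 \<le> arccos c"
    using assms arccos_lbound by auto
  then have "arccos a = arccos c + \<theta>"
    using R assms by (simp add: arccos_cos)
  then show "\<theta> \<le> arccos a \<and> c = cos (arccos a - \<theta>)"
    using \<open>0 \<le> arccos c\<close> assms by simp
qed

text \<open>Equality in Cauchy-Schwarz would make \<open>y\<close> a multiple of \<open>x\<close>.
  The condition \<open>x \<noteq> y\<close> keeps the set \<open>{x, y}\<close> from collapsing to a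
  singleton, which is independent for every nonzero vector.\<close>

lemma independent_pair_abs_inner_less:
  fixes x y :: "'a::euclidean_space"
  assumes "x \<noteq> y" "independent {x, y}"
  shows "\<bar>x \<bullet> y\<bar> < norm x * norm y"
proof -
  have "x \<noteq> 0" "y \<noteq> 0"
    using assms(2) dependent_zero by blast+
  have "y \<notin> span {x}"
    using assms independent_insert[of y "{x}"] by (auto simp: insert_commute)
  then have "\<not> collinear {0, x, y}"
    using \<open>x \<noteq> 0\<close> \<open>y \<noteq> 0\<close> by (auto simp: collinear_lemma span_singleton)
  then show ?thesis
    using norm_cauchy_schwarz_equal[of x y] Cauchy_Schwarz_ineq2[of x y] by linarith
qed

lemma vangle_in_open_interval:
  fixes x y :: "'a::euclidean_space"
  assumes "x \<noteq> y" "independent {x, y}"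
  shows "vangle x y \<in> {0<..<pi}" "cos (vangle x y) = x \<bullet> y / (norm x * norm y)"
proof -
  let ?t = "x \<bullet> y / (norm x * norm y)"
  have lt: "\<bar>x \<bullet> y\<bar> < norm x * norm y"
    using independent_pair_abs_inner_less[OF assms] .
  then have "0 < norm x * norm y" by linarith
  then have "- 1 < ?t" "?t < 1"
    using lt by (auto simp: abs_less_iff less_divide_eq divide_less_eq)
  then show "vangle x y \<in> {0<..<pi}" "cos (vangle x y) = ?t"
    using arccos_lt_bounded[of ?t] by (simp_all add: vangle_def)
qed

theorem mainTheorem4:
  fixes \<gamma> :: "int \<Rightarrow> real" and L h :: nat and idx :: "'n::finite \<Rightarrow> nat"
    and g0 gh :: "real ^ 'n" and \<theta> \<alpha>0 \<alpha>h :: real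
  assumes "(\<lambda>k. (\<gamma> k)\<^sup>2) summable_on UNIV"
    and "1 \<le> L" and "bij_betw idx UNIV {..<L}"
    and "1 \<le> h"
    and "g0 = lag_vec \<gamma> idx 0" and "gh = lag_vec \<gamma> idx h"
    and "g0 \<noteq> gh" and "independent {g0, gh}"
    and "\<theta> = vangle g0 gh"
    and "\<alpha>0 \<in> {-1..1}" and "\<theta> \<le> arccos \<alpha>0"
    and "\<alpha>h = cos (arccos \<alpha>0 - \<theta>)"
  shows "\<theta> \<in> {0<..<pi} \<and>
    (\<forall>a\<in>{-1..1}. \<forall>c\<in>{-1..1}.
       (\<theta> \<le> arccos a \<and> c = cos (arccos a - \<theta>)) \<longleftrightarrow>
       (arccos c + \<theta> \<le> pi \<and> a = cos (arccos c + \<theta>))) \<and>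
    (\<exists>s. (\<forall>b. is_arg_max (\<lambda>b. gh \<bullet> b) (\<lambda>b. g0 \<bullet> b / norm g0 = \<alpha>0 \<and> b \<bullet> b = 1) b \<longleftrightarrow> b = s) \<and>
         (\<forall>b. is_arg_min (\<lambda>b. g0 \<bullet> b) (\<lambda>b. gh \<bullet> b / norm gh = \<alpha>h \<and> b \<bullet> b = 1) b \<longleftrightarrow> b = s) \<and>
         is_arg_max (\<lambda>b. vangle g0 b) (\<lambda>b. gh \<bullet> b / norm gh = \<alpha>h \<and> norm b = 1) s)"
proof -
  note \<theta>_def = assms(9)
  have "g0 \<noteq> 0" "gh \<noteq> 0"
    using \<open>independent {g0, gh}\<close> dependent_zero by blast+
  \<comment> \<open>Passing to unit vectors rescales each objective by a positive factor, so the
    optimisers stay the same.\<close>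
  define u w \<phi> where "u = g0 /\<^sub>R norm g0" and "w = gh /\<^sub>R norm gh" and "\<phi> = arccos \<alpha>0"
  have u: "norm u = 1" and w: "norm w = 1"
    using \<open>g0 \<noteq> 0\<close> \<open>gh \<noteq> 0\<close> by (simp_all add: u_def w_def)
  have g0: "g0 \<bullet> b = norm g0 * (u \<bullet> b)" and gh: "gh \<bullet> b = norm gh * (w \<bullet> b)" for b
    using \<open>g0 \<noteq> 0\<close> \<open>gh \<noteq> 0\<close> by (simp_all add: u_def w_def)
  have norms: "0 < norm g0" "0 < norm gh"
    using \<open>g0 \<noteq> 0\<close> \<open>gh \<noteq> 0\<close> by simp_all
  have \<theta>: "0 < \<theta>" "\<theta> < pi" and uw: "u \<bullet> w = cos \<theta>"
    using vangle_in_open_interval[OF \<open>g0 \<noteq> gh\<close> \<open>independent {g0, gh}\<close>]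
    by (simp_all add: \<theta>_def u_def w_def field_simps)
  have \<phi>: "\<theta> \<le> \<phi>" "\<phi> \<le> pi" and \<alpha>0: "\<alpha>0 = cos \<phi>" and \<alpha>h: "\<alpha>h = cos (\<phi> - \<theta>)"
    using assms(10-12) arccos_ubound[of \<alpha>0] by (auto simp: \<phi>_def)
  have "0 < sin \<theta>"
    using \<theta> by (rule sin_gt_zero)
  have "0 \<le> sin \<phi>"
    using \<theta> \<phi> by (intro sin_ge_zero) auto
  obtain s where s: "norm s = 1" "u \<bullet> s = cos \<phi>" "w \<bullet> s = cos (\<phi> - \<theta>)"
    and max: "\<And>b. \<lbrakk>norm b = 1; u \<bullet> b = cos \<phi>\<rbrakk> \<Longrightarrow> w \<bullet> b \<le> cos (\<phi> - \<theta>)"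
    and max_unique: "\<And>b. \<lbrakk>norm b = 1; u \<bullet> b = cos \<phi>; w \<bullet> b = cos (\<phi> - \<theta>)\<rbrakk> \<Longrightarrow> b = s"
    using unique_unit_vector_maximal_inner[OF u w uw \<open>0 < sin \<theta>\<close> \<open>0 \<le> sin \<phi>\<close>] by blast
  \<comment> \<open>Hypotheses of the second instance, with \<open>w\<close> and \<open>- u\<close>
    at angle \<open>pi - \<theta>\<close>. The assumption \<open>\<theta> \<le> \<phi>\<close> is
    what places \<open>\<phi> - \<theta>\<close> in [0, pi], where the sine is nonnegative.\<close>
  have dual: "norm (- u) = 1" "w \<bullet> (- u) = cos (pi - \<theta>)" "0 < sin (pi - \<theta>)" "0 \<le> sin (\<phi> - \<theta>)"
    using u uw \<open>0 < sin \<theta>\<close> \<theta> \<phi> by (auto simp: inner_commute cos_diff intro!: sin_ge_zero)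
  \<comment> \<open>The upper bound on \<open>- u \<bullet> b\<close> from that instance is
    \<open>- cos \<phi>\<close>; negating it gives the lower bound on the dual objective.\<close>
  have "cos (\<phi> - \<theta> - (pi - \<theta>)) = - cos \<phi>"
    by (simp add: cos_diff)
  then have min: "cos \<phi> \<le> u \<bullet> b" if "norm b = 1" "w \<bullet> b = cos (\<phi> - \<theta>)" for b
    using unique_unit_vector_maximal_inner[OF w dual] that by (metis inner_minus_left neg_le_iff_le)
  have feas0: "g0 \<bullet> b / norm g0 = \<alpha>0 \<and> b \<bullet> b = 1 \<longleftrightarrow> norm b = 1 \<and> u \<bullet> b = cos \<phi>" for b
    using norms by (auto simp: g0 \<alpha>0 norm_eq_1)
  have feash: "gh \<bullet> b / norm gh = \<alpha>h \<and> b \<bullet> b = 1 \<longleftrightarrow> norm b = 1 \<and> w \<bullet> b = cos (\<phi> - \<theta>)" for b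
    using norms by (auto simp: gh \<alpha>h norm_eq_1)
  have primal_iff: "is_arg_max (\<lambda>b. gh \<bullet> b) (\<lambda>b. g0 \<bullet> b / norm g0 = \<alpha>0 \<and> b \<bullet> b = 1) b \<longleftrightarrow> b = s" for b
    unfolding is_arg_max_def feas0 gh mult_less_cancel_left_pos[OF norms(2)]
    using s max max_unique by (metis leD linorder_neqE_linordered_idom)
  \<comment> \<open>Since \<open>s\<close> is dual feasible and attains the lower bound, every dual
    minimiser has \<open>u \<bullet> b = cos \<phi>\<close>. It is then primal feasible with the
    optimal primal value, so \<open>max_unique\<close> identifies it with \<open>s\<close>.\<close>
  have dual_iff: "is_arg_min (\<lambda>b. g0 \<bullet> b) (\<lambda>b. gh \<bullet> b / norm gh = \<alpha>h \<and> b \<bullet> b = 1) b \<longleftrightarrow> b = s" for b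
    unfolding is_arg_min_def feash g0 mult_less_cancel_left_pos[OF norms(1)]
    using s min max_unique by (metis leD linorder_neqE_linordered_idom)
  have vangle: "vangle g0 b = arccos (u \<bullet> b)" if "norm b = 1" for b
    using that norms by (simp add: vangle_def g0)
  \<comment> \<open>\<open>arccos\<close> is decreasing on [-1, 1], so minimising
    \<open>u \<bullet> b\<close> maximises the angle.\<close>
  have "arccos (u \<bullet> b) \<le> arccos (u \<bullet> s)" if "norm b = 1" "w \<bullet> b = cos (\<phi> - \<theta>)" for b
    using min[OF that] that s(2) norm_cauchy_schwarz[of u b] u by (intro arccos_le_arccos) auto
  then have max_angle: "is_arg_max (\<lambda>b. vangle g0 b) (\<lambda>b. gh \<bullet> b / norm gh = \<alpha>h \<and> norm b = 1) s"
    using s norms by (auto simp: is_arg_max_def gh \<alpha>h vangle not_less)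
  show ?thesis
  proof (intro conjI exI[of _ s] ballI allI)
    show "\<theta> \<in> {0<..<pi}"
      using \<theta> by simp
  qed (use \<theta> in \<open>simp_all only: primal_iff dual_iff max_angle arccos_shift_iff less_imp_le\<close>)
qed

end
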